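(* Let $(X,\mathrm{d}x)$ be a measure space and $f:X\to[0,\infty]$ a measurable function. For $p\in(0,\infty)$ and $x^*\in X$ let $$(p\text{-}\mathrm{softmax}\, f)(x^* ) := \left(\int_{x\in X} \big((f(x)\multimap f(x^* ))^*\big)^p\,\mathrm{d}x\right)^{*\,1/p},$$ where $(\cdot)^{*\,1/p}$ means: apply the duality $(-)^*$ and then raise to the power $1/p$ (this is the multiplicative semantics of the sentence $\forall^p(x\in X).\, f(x)\multimap f(x^* )$), and for $p=\infty$ let $$(\infty\text{-}\mathrm{softmax}\, f)(x^* ) := \bigwedge_{x\in X} \big(f(x)\multimap f(x^* )\big).$$ Then: (1) for every $p\in(0,\infty)$ and every $x^*\in X$, $$(p\text{-}\mathrm{softmax}\, f)(x^* ) = \left(\int_{x\in X} f(x)^p\,\mathrm{d}x\right)^{1/p}\multimap f(x^* ),\qquad\text{i.e. } \frac{f(x^* )}{\left(\int_{x\in X} f(x)^p\,\mathrm{d}x\right)^{1/p}};$$ (2) for $p=1$ this is the softmax of $f$: for every $x^*\in X$, $$(1\text{-}\mathrm{softmax}\, f)(x^* ) = (\mathrm{softmax}\, f)(x^* );$$ (3) for $p=\infty$ it recovers argmax through the unitary separator: for every $x^*\in X$, $$\lfloor(\infty\text{-}\mathrm{softmax}\, f)(x^* )\rfloor = (\mathrm{argmax}\, f)(x^* ),$$ i.e. $(\infty\text{-}\mathrm{softmax}\, f)(x^* )\ge 1$ if and only if $f(x)\le f(x^* )$ for all $x\in X$.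
   Context: Truth values are elements of $[0,\infty]$ with its usual order; $\bigwedge$ denotes infimum. Duality: $a^*:=1/a$ for $0<a<\infty$, $0^*:=\infty$, $\infty^*:=0$. Division $a\multimap b$ (also written as the fraction $b/a$): it equals $b/a$ for $a\in(0,\infty)$ and $b\in[0,\infty)$; $0\multimap b=\infty$ for every $b$; $a\multimap\infty=\infty$ for every $a$; and $\infty\multimap b=0$ for $b<\infty$. (Equivalently, $a\multimap -$ is right adjoint to $-\otimes a$, where $\otimes$ is multiplication extended by $0\otimes\infty=0$ and $a\otimes\infty=\infty$ for $a>0$.) For exponents $k\in(0,\infty)$: $0^k=0$, $\infty^k=\infty$. Integrals are Lebesgue integrals of $[0,\infty]$-valued measurable functions, with values in $[0,\infty]$. For $p\in(0,\infty)$ the positive and negative $p$-integrals of $a:X\to[0,\infty]$ are $\int^{p}_{x\in X} a(x)\,\mathrm{d}x:=\left(\int_{x\in X} a(x)^p\,\mathrm{d}x\right)^{1/p}$ and $\int^{-p}_{x\in X} a(x)\,\mathrm{d}x:=\left(\int^{p}_{x\in X} a(x)^*\,\mathrm{d}x\right)^*$. The soft universal quantifier $\forall^p$ is interpreted as $\int^{-p}$; at $p=\infty$ it is interpreted as $\bigwedge$. The softmax of $f$ is $(\mathrm{softmax}\, f)(x^* ):=\dfrac{f(x^* )}{\int_{x\in X} f(x)\,\mathrm{d}x}$, with the division convention above. The (Boolean) argmax predicate is $(\mathrm{argmax}\, f)(x^* ):=\big(\forall x\in X,\ f(x)\le f(x^* )\big)$. The unitary separator $\lfloor-\rfloor$ sends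 $a\in[0,\infty]$ to true if $a\ge1$ and to false otherwise. *)

theory Defs
  imports "HOL-Analysis.Analysis"
begin

text \<open>
  Truth values are elements of \<^typ>\<open>ennreal\<close>. The duality is the library's \<^const>\<open>inverse\<close>, for which
  \<open>inverse 0 = top\<close> and \<open>inverse top = 0\<close>. The library's division on \<^typ>\<open>ennreal\<close> is \<^emph>\<open>not\<close> the
  division of the theory: it satisfies \<open>0 / 0 = 0\<close> and \<open>top / top = 0\<close>, where the residual of the
  multiplication has the value \<open>top\<close>.
\<close>

definition lolli :: "ennreal \<Rightarrow> ennreal \<Rightarrow> ennreal" (infixr "\<multimap>" 60) where
  "a \<multimap> b = (if a = 0 \<or> b = top then top else b / a)"

lemma lolli_top_left: "b < top \<Longrightarrow> top \<multimap> b = 0"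
  by (auto simp: lolli_def)

lemma lolli_adjoint: "c * a \<le> b \<longleftrightarrow> c \<le> a \<multimap> b"
proof (cases "a = 0 \<or> b = top")
  case True
  then show ?thesis by (auto simp: lolli_def)
next
  case False
  show ?thesis
  proof (cases "a = top")
    case True
    with False show ?thesis by (auto simp: lolli_def ennreal_mult_top top_unique)
  next
    case a: False
    have "c * a \<le> b \<longleftrightarrow> c \<le> b / a"
    proof
      assume "c * a \<le> b"
      then have "c * a / a \<le> b / a" by (rule divide_right_mono_ennreal)
      then show "c \<le> b / a" using False a by (simp add: mult_divide_eq_ennreal)
    next
      assume "c \<le> b / a"
      then have "c * a \<le> b / a * a" by (rule mult_right_mono) simp
      then show "c * a \<le> b"
        using False a by (simp add: ennreal_divide_times ennreal_divide_self less_top)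
    qed
    with False show ?thesis by (simp add: lolli_def)
  qed
qed

text \<open>The power \<open>a\<^sup>k\<close>, meant for real exponents \<open>k > 0\<close>; then \<open>0\<^sup>k = 0\<close> because \<open>0 powr k = 0\<close>.\<close>

definition epow :: "ennreal \<Rightarrow> real \<Rightarrow> ennreal" where
  "epow a k = (if a = top then top else ennreal (enn2real a powr k))"

definition pos_integral :: "real \<Rightarrow> 'a measure \<Rightarrow> ('a \<Rightarrow> ennreal) \<Rightarrow> ennreal" where
  "pos_integral p M a = epow (\<integral>\<^sup>+x. epow (a x) p \<partial>M) (1 / p)"

definition neg_integral :: "real \<Rightarrow> 'a measure \<Rightarrow> ('a \<Rightarrow> ennreal) \<Rightarrow> ennreal" where
  "neg_integral p M a = inverse (pos_integral p M (\<lambda>x. inverse (a x)))"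

definition p_softmax :: "real \<Rightarrow> 'a measure \<Rightarrow> ('a \<Rightarrow> ennreal) \<Rightarrow> 'a \<Rightarrow> ennreal" where
  "p_softmax p M f xs = epow (inverse (\<integral>\<^sup>+x. epow (inverse (f x \<multimap> f xs)) p \<partial>M)) (1 / p)"

definition infty_softmax :: "'a measure \<Rightarrow> ('a \<Rightarrow> ennreal) \<Rightarrow> 'a \<Rightarrow> ennreal" where
  "infty_softmax M f xs = (INF x\<in>space M. f x \<multimap> f xs)"

lemma epow_inverse:
  assumes "0 < k"
  shows "epow (inverse a) k = inverse (epow a k)"
proof (cases a)
  case (real r)
  show ?thesis
  proof (cases "r = 0")
    case True
    with real show ?thesis by (simp add: epow_def)
  next
    case False
    with real have "0 < r" by simp
    with real show ?thesis
      by (simp add: epow_def inverse_ennreal powr_minus inverse_powr)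
  qed
next
  case top
  with assms show ?thesis by (simp add: epow_def)
qed

text \<open>The soft universal quantifier is interpreted by \<^const>\<open>neg_integral\<close>, so \<^const>\<open>p_softmax\<close> is
  the semantics of \<open>\<forall>\<^sup>p x. f x \<multimap> f xs\<close>:\<close>

lemma p_softmax_eq_neg_integral:
  "0 < p \<Longrightarrow> p_softmax p M f xs = neg_integral p M (\<lambda>x. f x \<multimap> f xs)"
  by (simp add: p_softmax_def neg_integral_def pos_integral_def epow_inverse)

definition softmax :: "'a measure \<Rightarrow> ('a \<Rightarrow> ennreal) \<Rightarrow> 'a \<Rightarrow> ennreal" where
  "softmax M f xs = (\<integral>\<^sup>+x. f x \<partial>M) \<multimap> f xs"

definition argmax :: "'a set \<Rightarrow> ('a \<Rightarrow> ennreal) \<Rightarrow> 'a \<Rightarrow> bool" where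
  "argmax X f xs \<longleftrightarrow> (\<forall>x\<in>X. f x \<le> f xs)"

definition unitary_separator :: "ennreal \<Rightarrow> bool" where
  "unitary_separator a \<longleftrightarrow> 1 \<le> a"

end

theory Submission
  imports Defs
begin

text \<open>
  With the convention \<open>0 * top = 0\<close> the residual is \<open>(a * b\<^sup>*)\<^sup>*\<close> without exceptions, so its dual
  \<open>f x * (f xs)\<^sup>*\<close> is linear in \<open>f x\<close>: powers distribute over it and the constant factor comes
  out of the integral. The case \<open>p = \<infinity>\<close> is the adjunction of residual and multiplication at the unit.
\<close>

lemma inverse_lolli: "inverse (a \<multimap> b) = a * inverse b"
proof (cases "a = 0 \<or> b = top")
  case True
  then show ?thesis by (auto simp: lolli_def)
next
  case False
  show ?thesis
  \<comment> \<open>Since \<open>a \<noteq> 0\<close> and \<open>b \<noteq> top\<close> here, no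
    product \<open>0 * top\<close> arises and both sides are \<open>top\<close>.\<close>
  proof (cases "a = top \<or> b = 0")
    case True
    with False show ?thesis
      by (auto simp: lolli_def divide_ennreal_def ennreal_mult_top ennreal_top_mult)
  next
    case finite: False
    with False obtain r s where "a = ennreal r" "b = ennreal s" "0 < r" "0 < s"
      by (cases a; cases b) (auto simp: less_le)
    then show ?thesis
      by (simp add: lolli_def inverse_ennreal divide_ennreal flip: ennreal_mult)
        (simp add: field_simps)
  qed
qed

lemma ennreal_inverse_inverse: "inverse (inverse a) = (a :: ennreal)"
proof (cases a)
  case (real r)
  then show ?thesis
    by (cases "r = 0") (auto simp: inverse_ennreal less_le)
qed auto

text \<open>Reduces power laws for the residual to those for products and duals.\<close>

lemma lolli_eq_inverse_mult: "a \<multimap> b = inverse (a * inverse b)"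
  by (metis inverse_lolli ennreal_inverse_inverse)

text \<open>The infinite cases agree because \<open>epow\<close> fixes \<open>0\<close> and
  \<open>top\<close> and keeps positive finite values positive and finite.\<close>

lemma epow_mult:
  assumes "0 < k"
  shows "epow (a * b) k = epow a k * epow b k"
  using assms
  by (cases a; cases b)
    (auto simp: epow_def ennreal_mult_top ennreal_top_mult ennreal_mult_eq_top_iff
        enn2real_mult powr_mult ennreal_mult)

lemma epow_lolli: "0 < k \<Longrightarrow> epow (a \<multimap> b) k = epow a k \<multimap> epow b k"
  by (simp add: lolli_eq_inverse_mult epow_inverse epow_mult)

lemma epow_epow_inverse: "0 < p \<Longrightarrow> epow (epow a p) (1 / p) = a"
  by (cases a) (auto simp: epow_def powr_powr)

lemma epow_one: "epow a 1 = a"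
  by (cases a) (auto simp: epow_def)

lemma borel_measurable_epow [measurable]:
  assumes [measurable]: "f \<in> borel_measurable M"
  shows "(\<lambda>x. epow (f x) k) \<in> borel_measurable M"
  unfolding epow_def by measurable

lemma p_softmax_eq_lolli:
  assumes [measurable]: "f \<in> borel_measurable M" and p: "0 < p"
  shows "p_softmax p M f xs = epow (\<integral>\<^sup>+x. epow (f x) p \<partial>M) (1 / p) \<multimap> f xs"
proof -
  \<comment> \<open>The constant factor is \<open>top\<close> when \<open>f xs = 0\<close>; it still
    comes out of the integral.\<close>
  have "(\<integral>\<^sup>+x. epow (inverse (f x \<multimap> f xs)) p \<partial>M)
      = (\<integral>\<^sup>+x. epow (f x) p \<partial>M) * inverse (epow (f xs) p)"
    using p by (simp add: inverse_lolli epow_mult epow_inverse nn_integral_multc)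
  then have "p_softmax p M f xs = epow ((\<integral>\<^sup>+x. epow (f x) p \<partial>M) \<multimap> epow (f xs) p) (1 / p)"
    by (simp add: p_softmax_def lolli_eq_inverse_mult)
  \<comment> \<open>The root passes to both arguments of the residual and cancels the power of
    \<open>f xs\<close>.\<close>
  with p show ?thesis
    by (simp add: epow_lolli epow_epow_inverse)
qed

lemma one_le_lolli_iff: "1 \<le> a \<multimap> b \<longleftrightarrow> a \<le> b"
  using lolli_adjoint[of 1 a b] by simp

theorem mainTheorem1:
  fixes M :: "'a measure" and f :: "'a \<Rightarrow> ennreal"
  assumes f_meas: "f \<in> borel_measurable M"
  shows "(\<forall>p::real. \<forall>xs\<in>space M. 0 < p \<longrightarrow>
            p_softmax p M f xs = epow (\<integral>\<^sup>+x. epow (f x) p \<partial>M) (1 / p) \<multimap> f xs)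
       \<and> (\<forall>xs\<in>space M. p_softmax 1 M f xs = softmax M f xs)
       \<and> (\<forall>xs\<in>space M. unitary_separator (infty_softmax M f xs) = argmax (space M) f xs)"
proof (intro conjI)
  show "\<forall>p::real. \<forall>xs\<in>space M. 0 < p \<longrightarrow>
      p_softmax p M f xs = epow (\<integral>\<^sup>+x. epow (f x) p \<partial>M) (1 / p) \<multimap> f xs"
    using p_softmax_eq_lolli[OF f_meas] by simp
  show "\<forall>xs\<in>space M. p_softmax 1 M f xs = softmax M f xs"
    using p_softmax_eq_lolli[OF f_meas, of 1] by (simp add: epow_one softmax_def)
  \<comment> \<open>An infimum is at least \<open>1\<close> iff every member is, so the test is
    pointwise.\<close>
  show "\<forall>xs\<in>space M. unitary_separator (infty_softmax M f xs) = argmax (space M) f xs"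
    by (simp add: unitary_separator_def infty_softmax_def argmax_def le_INF_iff one_le_lolli_iff)
qed

end
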